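(* Let $$\alpha(t)=\begin{cases}\dfrac{1}{|\ln t|}, & 0<t\le e^{-1},\\[1ex] 1, & e^{-1}\le t\le 1.\end{cases}$$ Then $R^{\alpha(\cdot)}$ is not bounded in $L_1[0,1]$.
   Context: For a measurable function $\alpha$ on $[0,1]$ (defined and positive almost everywhere), the Riemann--Liouville operator of variable order is $$(R^{\alpha(\cdot)}f)(t):=\frac{1}{\Gamma(\alpha(t))}\int_0^t (t-s)^{\alpha(t)-1}f(s)\,ds,\qquad t\in[0,1],$$ for $f\in L_1[0,1]$ (the integral exists for almost every $t$). "Bounded in $L_1[0,1]$" means that it is a bounded linear operator from $L_1[0,1]$ to $L_1[0,1]$. *)

theory Defs
  imports "HOL-Analysis.Analysis"
begin

text \<open>Elements of $L_1[0,1]$ are represented by Lebesgue integrable functions on the unit interval;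
  equality in $L_1[0,1]$ is equality almost everywhere.\<close>

abbreviation unit_leb :: "real measure" where
  "unit_leb \<equiv> lebesgue_on {0..1}"

definition L1_norm :: "(real \<Rightarrow> real) \<Rightarrow> real" where
  "L1_norm f = (LINT t|unit_leb. \<bar>f t\<bar>)"

text \<open>The Bochner integral is 0 where the integral does not exist; for \<open>f\<close> in $L_1[0,1]$ and
  \<open>\<alpha>\<close> positive almost everywhere this concerns only a null set of \<open>t\<close>.
  The value of the kernel at \<open>s = t\<close> (where \<open>0 powr _ = 0\<close>) is irrelevant.\<close>

definition RL_var :: "(real \<Rightarrow> real) \<Rightarrow> (real \<Rightarrow> real) \<Rightarrow> real \<Rightarrow> real" where
  "RL_var \<alpha> f t =
     1 / Gamma (\<alpha> t) * (LINT s:{0..t}|lebesgue. (t - s) powr (\<alpha> t - 1) * f s)"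

text \<open>An operator on representatives that is a bounded linear operator from $L_1[0,1]$ to
  $L_1[0,1]$. Compatibility with equality almost everywhere is not listed, because it follows from
  linearity and the norm bound.\<close>

definition bounded_linear_L1 :: "((real \<Rightarrow> real) \<Rightarrow> real \<Rightarrow> real) \<Rightarrow> bool" where
  "bounded_linear_L1 T \<longleftrightarrow>
     (\<forall>f. integrable unit_leb f \<longrightarrow> integrable unit_leb (T f)) \<and>
     (\<forall>f g. integrable unit_leb f \<longrightarrow> integrable unit_leb g \<longrightarrow>
        (AE t in unit_leb. T (\<lambda>s. f s + g s) t = T f t + T g t)) \<and>
     (\<forall>c f. integrable unit_leb f \<longrightarrow>
        (AE t in unit_leb. T (\<lambda>s. c * f s) t = c * T f t)) \<and>
     (\<exists>C. \<forall>f. integrable unit_leb f \<longrightarrow> L1_norm (T f) \<le> C * L1_norm f)"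

end

theory Submission
  imports Defs
begin

text \<open>The normalised indicator functions \<open>f\<^sub>a = 1/a\<close> on $[0,a]$ have norm 1 in $L_1[0,1]$, but their
  images have unbounded norms. Indeed, write \<open>\<beta> = \<alpha>(t) = 1/\<bar>ln t\<bar>\<close> for \<open>a < t \<le> 1/e\<close>.
  Since \<open>\<beta> \<le> 1\<close>, the kernel \<open>(t - s) powr (\<beta> - 1)\<close> is at least \<open>t powr (\<beta> - 1)\<close>, and so is its
  average over $[0,a]$ (\<open>kernel_average_ge\<close>). The order is chosen so that \<open>t powr \<beta> = 1/e\<close> is
  constant, hence \<open>t powr (\<beta> - 1) = 1/(e t)\<close>. Moreover \<open>1/\<Gamma>(\<beta>) = \<beta>/\<Gamma>(1+\<beta>) \<ge> \<beta>\<close>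
  by log-convexity of \<open>\<Gamma>\<close> (\<open>inverse_Gamma_ge\<close>). Therefore the image of \<open>f\<^sub>a\<close> at \<open>t\<close> is at
  least \<open>1/(e t \<bar>ln t\<bar>)\<close>, independently of \<open>a\<close>, and the integral of this function over
  \<open>[h, 1/e]\<close> is \<open>ln \<bar>ln h\<bar> / e\<close>, which tends to infinity as \<open>h\<close> tends to 0
  (\<open>has_integral_inverse_mult_ln\<close>).\<close>

lemma Gamma_le_1:
  fixes x :: real
  assumes "1 \<le> x" "x \<le> 2"
  shows "Gamma x \<le> 1"
proof -
  have "(ln \<circ> Gamma) ((1 - (x - 1)) *\<^sub>R 1 + (x - 1) *\<^sub>R (2::real))
      \<le> (1 - (x - 1)) * (ln \<circ> Gamma) 1 + (x - 1) * (ln \<circ> Gamma) (2::real)"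
    using assms by (intro convex_onD[OF log_convex_Gamma_real]) auto
  moreover have "Gamma (2::real) = 1"
    using Gamma_fact[of 1, where ?'a = real] by simp
  ultimately have "ln (Gamma x) \<le> 0"
    by (simp add: algebra_simps)
  moreover have "Gamma x > 0"
    using assms by (intro Gamma_real_pos) auto
  ultimately show ?thesis by simp
qed

lemma inverse_Gamma_ge:
  fixes b :: real
  assumes "0 < b" "b \<le> 1"
  shows "b \<le> 1 / Gamma b"
proof -
  have pos: "Gamma b > 0"
    using assms by (intro Gamma_real_pos)
  have "b * Gamma b = Gamma (b + 1)"
    using assms by (subst Gamma_plus1) (auto elim: nonpos_Ints_cases)
  also have "\<dots> \<le> 1"
    using assms by (intro Gamma_le_1) auto
  finally show ?thesis
    using pos by (simp add: field_simps)
qed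

lemma set_integrable_lebesgue_continuous:
  fixes k :: "real \<Rightarrow> real"
  assumes "continuous_on {a..b} k"
  shows "set_integrable lebesgue {a..b} k"
proof -
  have "set_integrable lborel {a..b} k"
    using assms by (rule borel_integrable_atLeastAtMost')
  then show ?thesis
    unfolding set_integrable_def
    by (subst integrable_completion) (auto dest: borel_measurable_integrable)
qed

lemma kernel_average_ge:
  fixes a b t :: real
  assumes "0 < a" "a < t" "b \<le> 1"
  shows "t powr (b - 1) \<le>
    (LINT s:{0..t}|lebesgue. (t - s) powr (b - 1) * (indicator {0..a} s / a))"
proof -
  define k where "k = (\<lambda>s. (t - s) powr (b - 1) / a)"
  have k: "set_integrable lebesgue {0..a} k"
    unfolding k_def using assms
    by (intro set_integrable_lebesgue_continuous continuous_intros) auto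
  have c: "set_integrable lebesgue {0..a} (\<lambda>s. t powr (b - 1) / a)"
    by (intro set_integrable_lebesgue_continuous continuous_on_const)
  have "t powr (b - 1) = (LINT s:{0..a}|lebesgue. t powr (b - 1) / a)"
    using assms by (simp add: set_lebesgue_integral_def)
  also have "\<dots> \<le> (LINT s:{0..a}|lebesgue. k s)"
    using assms unfolding k_def
    by (intro set_integral_mono c k[unfolded k_def] divide_right_mono powr_mono2') auto
  also have "\<dots> = (LINT s:{0..t}|lebesgue. (t - s) powr (b - 1) * (indicator {0..a} s / a))"
    unfolding set_lebesgue_integral_def k_def using assms
    by (intro Bochner_Integration.integral_cong) (auto simp: indicator_def)
  finally show ?thesis .
qed

lemma RL_var_indicator_ge:
  fixes a t :: real
  assumes "0 < a" "a < t" "t \<le> exp (-1)" "\<alpha> t = 1 / \<bar>ln t\<bar>"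
  shows "exp (-1) * (1 / (t * - ln t)) \<le> RL_var \<alpha> (\<lambda>s. indicator {0..a} s / a) t"
proof -
  define b where "b = 1 / - ln t"
  have t: "t > 0" using assms by simp
  then have "ln t \<le> -1"
    using assms(3) by (metis exp_gt_zero ln_exp ln_le_cancel_iff)
  then have ab: "\<alpha> t = b" and b: "0 < b" "b \<le> 1" and bln: "b * ln t = -1"
    using assms(4) unfolding b_def by (simp_all add: divide_le_eq le_divide_eq zero_less_divide_iff)
  have "t powr (b - 1) = exp (-1) / t"
    using t bln by (simp add: powr_diff) (simp add: powr_def)
  then have "exp (-1) * (1 / (t * - ln t)) = b * t powr (b - 1)"
    by (simp add: b_def)
  also have "\<dots> \<le> 1 / Gamma b *
      (LINT s:{0..t}|lebesgue. (t - s) powr (b - 1) * (indicator {0..a} s / a))"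
    using b assms by (intro mult_mono inverse_Gamma_ge kernel_average_ge) (auto simp: less_imp_le)
  finally show ?thesis
    by (simp add: RL_var_def ab)
qed

lemma has_integral_inverse_mult_ln:
  fixes h :: real
  assumes "0 < h" "h \<le> exp (-1)"
  shows "((\<lambda>t. 1 / (t * - ln t)) has_integral ln (- ln h)) {h..exp (-1)}"
proof -
  have "((\<lambda>t. 1 / (t * - ln t)) has_integral (- ln (- ln (exp (-1))) - - ln (- ln h))) {h..exp (-1)}"
  proof (rule fundamental_theorem_of_calculus)
    fix t assume t: "t \<in> {h..exp (-1::real)}"
    then have "t > 0" using assms by auto
    moreover from this t have "ln t \<le> -1"
      by (metis atLeastAtMost_iff exp_gt_zero ln_exp ln_le_cancel_iff)
    moreover have "t < 1"
      using t by (auto intro: le_less_trans[of _ "exp (-1)"])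
    ultimately have "((\<lambda>t. - ln (- ln t)) has_real_derivative 1 / (t * - ln t)) (at t)"
      by (auto intro!: derivative_eq_intros simp: field_simps)
    then show "((\<lambda>t. - ln (- ln t)) has_vector_derivative 1 / (t * - ln t))
        (at t within {h..exp (-1)})"
      by (simp add: has_real_derivative_iff_has_vector_derivative has_vector_derivative_at_within)
  qed (use assms in auto)
  then show ?thesis by simp
qed

lemma
  fixes a :: real
  assumes "0 < a" "a \<le> 1"
  shows integrable_normalised_indicator: "integrable unit_leb (\<lambda>s. indicator {0..a} s / a)"
    and L1_norm_normalised_indicator: "L1_norm (\<lambda>s. indicator {0..a} s / a) = 1"
proof -
  have sub: "{0..1} \<inter> {0..a} = {0..a}" using assms by auto
  have S: "{0..a} \<in> sets unit_leb"
    using assms by (auto simp: sets_restrict_space sub intro!: image_eqI[of _ _ "{0..a}"])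
  have m: "emeasure unit_leb {0..a} = ennreal a"
    using assms by (subst emeasure_restrict_space) auto
  show "integrable unit_leb (\<lambda>s. indicator {0..a} s / a)"
    using S m by (intro integrable_divide integrable_real_indicator) auto
  have "measure unit_leb {0..a} = a"
    using m assms by (simp add: measure_def)
  moreover have "{0..a} \<inter> space unit_leb = {0..a}"
    using assms by auto
  ultimately show "L1_norm (\<lambda>s. indicator {0..a} s / a) = 1"
    using S assms by (simp add: L1_norm_def)
qed

theorem proposition3p4:
  fixes \<alpha> :: "real \<Rightarrow> real"
  assumes "\<And>t. 0 < t \<Longrightarrow> t \<le> exp (-1) \<Longrightarrow> \<alpha> t = 1 / \<bar>ln t\<bar>"
    and "\<And>t. exp (-1) \<le> t \<Longrightarrow> t \<le> 1 \<Longrightarrow> \<alpha> t = 1"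
  shows "\<not> bounded_linear_L1 (RL_var \<alpha>)"
proof
  assume "bounded_linear_L1 (RL_var \<alpha>)"
  then have int: "\<And>f. integrable unit_leb f \<Longrightarrow> integrable unit_leb (RL_var \<alpha> f)"
    and "\<exists>C. \<forall>f. integrable unit_leb f \<longrightarrow> L1_norm (RL_var \<alpha> f) \<le> C * L1_norm f"
    unfolding bounded_linear_L1_def by simp_all
  then obtain C where
    C: "\<forall>f. integrable unit_leb f \<longrightarrow> L1_norm (RL_var \<alpha> f) \<le> C * L1_norm f"
    by (elim exE)
  \<comment> \<open>This \<open>h\<close> makes the lower bound \<open>exp (-1) * ln (- ln h)\<close> equal to \<open>\<bar>C\<bar> + 1\<close>.\<close>
  define h where "h = exp (- exp (exp 1 * (\<bar>C\<bar> + 1)))"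
  have h: "0 < h" "h \<le> exp (-1)"
    by (auto simp: h_def)
  have lnh: "exp (-1) * ln (- ln h) = \<bar>C\<bar> + 1"
    by (simp add: h_def exp_add[symmetric] mult.assoc[symmetric])
  \<comment> \<open>The support ends strictly before \<open>h\<close>, so the pointwise bound also holds at \<open>t = h\<close>.\<close>
  define f :: "real \<Rightarrow> real" where "f = (\<lambda>s. indicator {0..h/2} s / (h/2))"
  have "h \<le> 1" using h(2) by (rule order_trans) simp
  then have f: "integrable unit_leb f" "L1_norm f = 1"
    unfolding f_def using h
    by (intro integrable_normalised_indicator L1_norm_normalised_indicator; simp)+
  have absint: "integrable unit_leb (\<lambda>t. \<bar>RL_var \<alpha> f t\<bar>)"
    using int[OF f(1)] by (rule integrable_abs)
  have sub: "{h..exp (-1)} \<subseteq> {0..1::real}"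
    using h(1) by (auto intro: order_trans[of _ "exp (-1)"])
  have abs_on: "(\<lambda>t. \<bar>RL_var \<alpha> f t\<bar>) integrable_on {0..1}"
    using absint by (rule integrable_on_lebesgue_on) simp
  have "((\<lambda>t. if t \<in> {h..exp (-1)} then exp (-1) * (1 / (t * - ln t)) else 0)
      has_integral exp (-1) * ln (- ln h)) {0..1}"
    unfolding has_integral_restrict[OF sub]
    by (intro has_integral_mult_right has_integral_inverse_mult_ln h)
  moreover have "((\<lambda>t. \<bar>RL_var \<alpha> f t\<bar>) has_integral L1_norm (RL_var \<alpha> f)) {0..1}"
    using abs_on lebesgue_integral_eq_integral[OF absint]
    by (simp add: L1_norm_def integrable_integral)
  moreover have "(if t \<in> {h..exp (-1)} then exp (-1) * (1 / (t * - ln t)) else 0)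
      \<le> \<bar>RL_var \<alpha> f t\<bar>" for t
  proof (cases "t \<in> {h..exp (-1)}")
    case True
    then have "exp (-1) * (1 / (t * - ln t)) \<le> RL_var \<alpha> f t"
      unfolding f_def using h by (intro RL_var_indicator_ge assms(1)) auto
    with True show ?thesis by simp
  qed auto
  ultimately have "exp (-1) * ln (- ln h) \<le> L1_norm (RL_var \<alpha> f)"
    by (rule has_integral_le)
  also have "\<dots> \<le> C"
    using C[rule_format, OF f(1)] f(2) by simp
  finally show False
    using lnh by simp
qed

end
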